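(* Let $\mathcal{J}$ be a subset of $\{1,2,\dots,n\}$ and assume that $\mathbf{e}_j\in\mathcal{N}(\mathsf{A})^\perp$ for all $j\in\mathcal{J}$. Let $\tilde{j}\in\{1,\dots,n\}\setminus\mathcal{J}$ and let $x_j^*$ ($j\in\mathcal{J}$) and $x_{\tilde{j}}^*$ be real numbers. If $$\mathsf{A}\mathbf{e}_i\neq\eta\,\mathsf{A}\mathbf{e}_k\quad\forall i,k\in\{1,\dots,n\},\ i\neq k,\ \forall\eta\in\mathbb{R},$$ then $$\mathsf{x}^*=\sum_{j\in\mathcal{J}}x_j^*\mathbf{e}_j+x_{\tilde{j}}^*\mathbf{e}_{\tilde{j}}$$ is the unique solution of $$\min_{\mathbf{x}\in\mathbb{R}^n}\|\mathsf{W}\mathbf{x}\|_1\quad\text{subject to}\quad\mathsf{A}\mathbf{x}=\mathsf{A}\mathsf{x}^*.$$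
   Context: $\mathsf{A}\in\mathbb{R}^{m\times n}$ is a matrix with nontrivial null space $\mathcal{N}(\mathsf{A})$, $\mathsf{A}^\dagger$ is its Moore-Penrose pseudo-inverse, and $\mathsf{P}=\mathsf{A}^\dagger\mathsf{A}$ is the orthogonal projection of $\mathbb{R}^n$ onto $\mathcal{N}(\mathsf{A})^\perp$. $\mathbf{e}_1,\dots,\mathbf{e}_n$ are the standard basis vectors of $\mathbb{R}^n$, and it is assumed that $\mathsf{P}\mathbf{e}_i\neq 0$ for all $i$. $\mathsf{W}\in\mathbb{R}^{n\times n}$ is the diagonal matrix defined by $\mathsf{W}\mathbf{e}_i=\|\mathsf{P}\mathbf{e}_i\|_2\,\mathbf{e}_i$. *)

theory Defs
  imports "HOL-Analysis.Analysis"
begin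

definition null_space :: "real^'n^'m \<Rightarrow> (real^'n) set" where
  "null_space A = {x. A *v x = 0}"

text \<open>The four Penrose equations.\<close>

definition is_pinv :: "real^'n^'m \<Rightarrow> real^'m^'n \<Rightarrow> bool" where
  "is_pinv A X \<longleftrightarrow>
     A ** X ** A = A \<and> X ** A ** X = X \<and>
     transpose (A ** X) = A ** X \<and> transpose (X ** A) = X ** A"

definition pinv :: "real^'n^'m \<Rightarrow> real^'m^'n" where
  "pinv A = (THE X. is_pinv A X)"

definition proj_mat :: "real^'n^'m \<Rightarrow> real^'n^'n" where
  "proj_mat A = pinv A ** A"

definition weight_mat :: "real^'n^'m \<Rightarrow> real^'n^'n" where
  "weight_mat A = (\<chi> i j. if i = j then norm (proj_mat A *v axis i 1) else 0)"

text \<open>On \<open>real^'n\<close> the library's \<open>norm\<close> is the Euclidean norm.\<close>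

definition norm_l1 :: "real^'n \<Rightarrow> real" where
  "norm_l1 x = (\<Sum>i\<in>UNIV. \<bar>x $ i\<bar>)"

text \<open>The description operator in \<open>pinv\<close> is justified: the Penrose equations have exactly one
  solution.\<close>

lemma is_pinv_unique:
  fixes A :: "real^'n^'m"
  assumes X: "is_pinv A X" and Y: "is_pinv A Y"
  shows "X = Y"
proof -
  have AXA: "A ** X ** A = A" and XAX: "X ** A ** X = X"
    and AX: "transpose (A ** X) = A ** X" and XA: "transpose (X ** A) = X ** A"
    using X unfolding is_pinv_def by auto
  have AYA: "A ** Y ** A = A" and YAY: "Y ** A ** Y = Y"
    and AY: "transpose (A ** Y) = A ** Y" and YA: "transpose (Y ** A) = Y ** A"
    using Y unfolding is_pinv_def by auto
  have "A ** X = transpose ((A ** Y) ** (A ** X))"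
    using AYA AX by (simp add: matrix_mul_assoc)
  also have "\<dots> = (A ** X) ** (A ** Y)"
    using AX AY by (simp add: matrix_transpose_mul)
  also have "\<dots> = A ** Y"
    using AXA by (simp add: matrix_mul_assoc)
  finally have 1: "A ** X = A ** Y" .
  have "X ** A = transpose ((X ** A) ** (Y ** A))"
    using AYA XA by (metis matrix_mul_assoc)
  also have "\<dots> = (Y ** A) ** (X ** A)"
    using XA YA by (simp add: matrix_transpose_mul)
  also have "\<dots> = Y ** A"
    using AXA by (metis matrix_mul_assoc)
  finally have 2: "X ** A = Y ** A" .
  show ?thesis
    using 1 2 XAX YAY by (metis matrix_mul_assoc)
qed

lemma is_pinv_exists:
  fixes A :: "real^'n^'m"
  shows "\<exists>X. is_pinv A X"
proof -
  define R where "R = (null_space A)\<^sup>\<bottom>"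
  have sub_N: "subspace (null_space A)"
    unfolding null_space_def
    by (auto simp: subspace_def matrix_vector_right_distrib matrix_vector_mult_scaleR)
  have sub_R: "subspace R"
    unfolding R_def by (rule subspace_orthogonal_comp)
  define Q where "Q y r \<longleftrightarrow> r \<in> R \<and> (\<forall>x. (y - A *v r) \<bullet> (A *v x) = 0)" for y r
  have R_null: "r = 0" if "r \<in> R" "A *v r = 0" for r
    using that by (auto simp: R_def orthogonal_comp_def null_space_def orthogonal_def)
  have Q_ex: "\<exists>r. Q y r" for y
  proof -
    have sub: "subspace (range ((*v) A))"
      by (simp add: linear_subspace_image)
    obtain p q where p: "p \<in> span (range ((*v) A))" and yq: "y = p + q"
      and q: "\<And>w. w \<in> span (range ((*v) A)) \<Longrightarrow> orthogonal q w"
      by (rule orthogonal_subspace_decomp_exists[of "range ((*v) A)" y]) blast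
    obtain u where u: "p = A *v u"
      using p sub by (auto simp: span_eq_iff[THEN iffD2])
    obtain s r where s: "s \<in> span (null_space A)" and ur: "u = s + r"
      and r: "\<And>w. w \<in> span (null_space A) \<Longrightarrow> orthogonal r w"
      by (rule orthogonal_subspace_decomp_exists[of "null_space A" u]) blast
    have "A *v s = 0"
      using s sub_N by (auto simp: span_eq_iff[THEN iffD2] null_space_def)
    then have "A *v r = p"
      using u ur by (simp add: matrix_vector_right_distrib)
    moreover have "r \<in> R"
      using r by (auto simp: R_def orthogonal_comp_def orthogonal_commute span_base)
    moreover have "q \<bullet> (A *v x) = 0" for x
      using q by (auto simp: orthogonal_def span_base)
    ultimately have "Q y r"
      using yq by (simp add: Q_def)
    then show ?thesis ..
  qed
  have Q_uniq: "r = r'" if "Q y r" "Q y r'" for y r r'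
  proof -
    have "(A *v (r - r')) \<bullet> (A *v x) = 0" for x
    proof -
      have "(y - A *v r) \<bullet> (A *v x) = 0" "(y - A *v r') \<bullet> (A *v x) = 0"
        using that by (auto simp: Q_def)
      then show ?thesis
        by (simp add: matrix_vector_mult_diff_distrib inner_diff_left)
    qed
    from this[of "r - r'"] have "A *v (r - r') = 0" by simp
    moreover have "r - r' \<in> R"
      using that sub_R by (auto simp: Q_def subspace_diff)
    ultimately show ?thesis using R_null by fastforce
  qed
  obtain f where f: "\<And>y. Q y (f y)" using Q_ex by metis
  have "linear f"
  proof (rule linearI)
    fix a b
    have "Q (a + b) (f a + f b)"
      using f[of a] f[of b] sub_R
      by (auto simp: Q_def subspace_add matrix_vector_right_distrib inner_diff_left inner_add_left)
    then show "f (a + b) = f a + f b" using Q_uniq f by blast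
  next
    fix c :: real and a
    have "Q (c *\<^sub>R a) (c *\<^sub>R f a)"
      using f[of a] sub_R
      by (auto simp: Q_def subspace_scale matrix_vector_mult_scaleR inner_diff_left)
    then show "f (c *\<^sub>R a) = c *\<^sub>R f a" using Q_uniq f by blast
  qed
  then have fX: "matrix f *v y = f y" for y
    by simp
  define X where "X = matrix f"
  have X: "X *v y = f y" for y using fX X_def by simp
  have fR: "f y \<in> R" for y using f by (simp add: Q_def)
  have fO: "y \<bullet> (A *v x) = (A *v f y) \<bullet> (A *v x)" for y x
    using f[of y] by (simp add: Q_def inner_diff_left)
  have AfA: "A *v f (A *v x) = A *v x" for x
  proof -
    have "(A *v (x - f (A *v x))) \<bullet> (A *v z) = 0" for z
      using fO[of "A *v x" z] by (simp add: matrix_vector_mult_diff_distrib inner_diff_left)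
    from this[of "x - f (A *v x)"] show ?thesis
      by (simp add: matrix_vector_mult_diff_distrib)
  qed
  have fAf: "f (A *v f y) = f y" for y
  proof -
    have "f (A *v f y) - f y \<in> R" using fR sub_R by (simp add: subspace_diff)
    moreover have "A *v (f (A *v f y) - f y) = 0"
      by (simp add: matrix_vector_mult_diff_distrib AfA)
    ultimately show ?thesis using R_null by fastforce
  qed
  have R_orth: "r \<bullet> x = r \<bullet> f (A *v x)" if "r \<in> R" for r x
  proof -
    have "x - f (A *v x) \<in> null_space A"
      by (simp add: null_space_def matrix_vector_mult_diff_distrib AfA)
    then have "(x - f (A *v x)) \<bullet> r = 0"
      using that by (auto simp: R_def orthogonal_comp_def orthogonal_def)
    then show ?thesis by (simp add: inner_diff_left inner_commute[of r])
  qed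
  have sym: "transpose M = M" if "\<And>x y. (M *v x) \<bullet> y = x \<bullet> (M *v y)" for M :: "real^'k^'k"
  proof -
    have "transpose M *v y = M *v y" for y
    proof -
      have "x \<bullet> (transpose M *v y - M *v y) = 0" for x
      proof -
        have "x \<bullet> (transpose M *v y) = (M *v x) \<bullet> y"
          by (metis dot_lmul_matrix inner_commute transpose_matrix_vector)
        then show ?thesis using that[of x y] by (simp add: inner_diff_right)
      qed
      from this[of "transpose M *v y - M *v y"] show ?thesis by simp
    qed
    then show ?thesis by (simp add: matrix_eq)
  qed
  have "is_pinv A X"
    unfolding is_pinv_def
  proof (intro conjI)
    show "A ** X ** A = A" "X ** A ** X = X"
      by (simp_all add: matrix_eq matrix_vector_mul_assoc[symmetric] X AfA fAf)
    show "transpose (A ** X) = A ** X"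
    proof (rule sym)
      fix x y
      have "(A *v f x) \<bullet> y = (A *v f y) \<bullet> (A *v f x)"
        using fO[of y "f x"] by (simp only: inner_commute[of "A *v f x" y])
      also have "\<dots> = x \<bullet> (A *v f y)"
        using fO[of x "f y"] by (simp only: inner_commute[of "A *v f y" "A *v f x"])
      finally show "((A ** X) *v x) \<bullet> y = x \<bullet> ((A ** X) *v y)"
        by (simp only: matrix_vector_mul_assoc[symmetric] X)
    qed
    show "transpose (X ** A) = X ** A"
    proof (rule sym)
      fix x y
      have "f (A *v x) \<bullet> y = f (A *v x) \<bullet> f (A *v y)"
        by (rule R_orth[OF fR])
      also have "\<dots> = x \<bullet> f (A *v y)"
        using R_orth[OF fR, of "A *v y" x]
        by (simp only: inner_commute[of "f (A *v x)"] inner_commute[of x])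
      finally show "((X ** A) *v x) \<bullet> y = x \<bullet> ((X ** A) *v y)"
        by (simp only: matrix_vector_mul_assoc[symmetric] X)
    qed
  qed
  then show ?thesis ..
qed

lemma is_pinv_pinv: "is_pinv A (pinv A)"
  unfolding pinv_def using is_pinv_exists is_pinv_unique by (metis theI)

lemma proj_mat_orthogonal_projection:
  "proj_mat A *v x \<in> (null_space A)\<^sup>\<bottom>" "x - proj_mat A *v x \<in> null_space A"
proof -
  have A: "A ** pinv A ** A = A" and sym: "transpose (proj_mat A) = proj_mat A"
    using is_pinv_pinv[of A] by (simp_all add: is_pinv_def proj_mat_def)
  show "x - proj_mat A *v x \<in> null_space A"
    using A by (simp add: null_space_def proj_mat_def matrix_vector_mult_diff_distrib
        matrix_vector_mul_assoc matrix_mul_assoc)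
  have "y \<bullet> (proj_mat A *v x) = 0" if "A *v y = 0" for y
  proof -
    have "proj_mat A *v y = 0"
      using that by (simp add: proj_mat_def matrix_vector_mul_assoc[symmetric])
    then show ?thesis
      by (metis dot_lmul_matrix inner_zero_left sym transpose_matrix_vector)
  qed
  then show "proj_mat A *v x \<in> (null_space A)\<^sup>\<bottom>"
    by (simp add: orthogonal_comp_def null_space_def orthogonal_def)
qed

lemma weight_mat_axis:
  "weight_mat A *v axis i 1 = norm (proj_mat A *v axis i 1) *\<^sub>R axis i 1"
  by (simp add: vec_eq_iff matrix_vector_mult_basis column_def weight_mat_def)
     (simp add: axis_def)

end

theory Submission
  imports Defs
begin

text \<open>
  Write \<open>P\<close> for the projection \<open>proj_mat A\<close> and \<open>w\<^sub>i = norm (P e\<^sub>i)\<close> for the weights. A competitor of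
  \<open>x\<^sup>*\<close> has the form \<open>x\<^sup>* + h\<close> with \<open>A h = 0\<close>. Each \<open>e\<^sub>j\<close> with \<open>j \<in> J\<close> is orthogonal to \<open>h\<close>, so
  \<open>h\<close> vanishes on \<open>J\<close>, while off \<open>J\<close> the only entry of \<open>x\<^sup>*\<close> that may differ from zero is the
  one at \<open>k\<close>. Hence passing from \<open>x\<^sup>*\<close> to \<open>x\<^sup>* + h\<close> raises the objective by
  \<open>\<Sum>i\<noteq>k. w\<^sub>i \<bar>h\<^sub>i\<bar>\<close> away from \<open>k\<close> and lowers it by at most \<open>w\<^sub>k \<bar>h\<^sub>k\<bar>\<close> at \<open>k\<close>.

  The gain is strictly larger than the loss because \<open>A h = 0\<close> says
  \<open>h\<^sub>k P e\<^sub>k = - (\<Sum>i\<noteq>k. h\<^sub>i P e\<^sub>i)\<close>: the triangle inequality gives \<open>\<le>\<close>, and it is strict since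
  every \<open>P e\<^sub>i\<close> with \<open>i \<noteq> k\<close> lies off the line spanned by \<open>P e\<^sub>k\<close>
  (\<open>norm_lt_sum_norm_of_vanishing_combination\<close>). The weights turn the norms of these terms into
  exactly the summands of the objective.
\<close>

text \<open>
  Projecting on the direction of \<open>v k\<close> replaces each norm \<open>norm (v i)\<close> by \<open>norm (v i)\<close> times a
  cosine, and for \<open>i \<noteq> k\<close> strict Cauchy-Schwarz keeps this cosine off \<open>\<plusminus>1\<close>. The combination must
  have a nonzero coefficient other than that of \<open>v k\<close>, as a single vector \<open>v k \<noteq> 0\<close> cannot cancel.
\<close>

lemma norm_lt_sum_norm_of_vanishing_combination:
  fixes v :: "'i::finite \<Rightarrow> 'a::real_inner" and h :: "'i \<Rightarrow> real"
  assumes vanish: "(\<Sum>i\<in>UNIV. h i *\<^sub>R v i) = 0"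
    and "v k \<noteq> 0"
    and not_parallel: "\<And>i \<eta>. i \<noteq> k \<Longrightarrow> v i \<noteq> \<eta> *\<^sub>R v k"
    and "h j \<noteq> 0"
  shows "norm (v k) * \<bar>h k\<bar> < (\<Sum>i\<in>UNIV - {k}. norm (v i) * \<bar>h i\<bar>)"
proof -
  have split: "h k *\<^sub>R v k = - (\<Sum>i\<in>UNIV - {k}. h i *\<^sub>R v i)"
    using vanish by (simp add: sum.remove[of UNIV k] eq_neg_iff_add_eq_0)
  have strict: "\<bar>v i \<bullet> v k\<bar> < norm (v i) * norm (v k)" if "i \<noteq> k" for i
  proof (rule ccontr)
    assume "\<not> ?thesis"
    then have "\<bar>v k \<bullet> v i\<bar> = norm (v k) * norm (v i)"
      using Cauchy_Schwarz_ineq2[of "v k" "v i"] by (simp add: inner_commute mult.commute)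
    then have "norm (v k) *\<^sub>R v i = norm (v i) *\<^sub>R v k \<or>
        norm (v k) *\<^sub>R v i = - norm (v i) *\<^sub>R v k"
      by (simp add: norm_cauchy_schwarz_abs_eq)
    then obtain c where "norm (v k) *\<^sub>R v i = c *\<^sub>R v k"
      by blast
    then have "v i = (c / norm (v k)) *\<^sub>R v k"
      using \<open>v k \<noteq> 0\<close> by (metis divide_inverse_commute norm_eq_zero scaleR_scaleR
          scaleR_one left_inverse)
    then show False
      using not_parallel that by blast
  qed
  have "\<exists>i. i \<noteq> k \<and> h i \<noteq> 0"
  proof (rule ccontr)
    assume only_k: "\<nexists>i. i \<noteq> k \<and> h i \<noteq> 0"
    then have "(\<Sum>i\<in>UNIV - {k}. h i *\<^sub>R v i) = 0"
      by (intro sum.neutral) auto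
    then have "h k *\<^sub>R v k = 0"
      using split by simp
    then show False
      using only_k \<open>h j \<noteq> 0\<close> \<open>v k \<noteq> 0\<close> by (metis scaleR_eq_0_iff)
  qed
  then obtain i0 where i0: "i0 \<noteq> k" "h i0 \<noteq> 0"
    by blast
  have "(norm (v k) * \<bar>h k\<bar>) * norm (v k) = \<bar>(h k *\<^sub>R v k) \<bullet> v k\<bar>"
    by (simp add: abs_mult dot_square_norm power2_eq_square)
  also have "\<dots> = \<bar>\<Sum>i\<in>UNIV - {k}. h i * (v i \<bullet> v k)\<bar>"
    unfolding split by (simp add: inner_sum_left)
  also have "\<dots> \<le> (\<Sum>i\<in>UNIV - {k}. \<bar>h i\<bar> * \<bar>v i \<bullet> v k\<bar>)"
    by (rule order_trans[OF sum_abs]) (simp add: abs_mult)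
  also have "\<dots> < (\<Sum>i\<in>UNIV - {k}. \<bar>h i\<bar> * (norm (v i) * norm (v k)))"
  proof (rule sum_strict_mono_ex1)
    show "\<forall>i\<in>UNIV - {k}. \<bar>h i\<bar> * \<bar>v i \<bullet> v k\<bar> \<le> \<bar>h i\<bar> * (norm (v i) * norm (v k))"
      by (simp add: mult_left_mono Cauchy_Schwarz_ineq2)
    show "\<exists>i\<in>UNIV - {k}. \<bar>h i\<bar> * \<bar>v i \<bullet> v k\<bar> < \<bar>h i\<bar> * (norm (v i) * norm (v k))"
      using i0 strict by (intro bexI[of _ i0] mult_strict_left_mono) auto
  qed simp
  also have "\<dots> = (\<Sum>i\<in>UNIV - {k}. norm (v i) * \<bar>h i\<bar>) * norm (v k)"
    unfolding sum_distrib_right by (simp add: mult_ac)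
  finally show ?thesis
    by (rule mult_right_less_imp_less) simp
qed

lemma norm_l1_weight_mat:
  "norm_l1 (weight_mat A *v x) = (\<Sum>i\<in>UNIV. norm (proj_mat A *v axis i 1) * \<bar>x $ i\<bar>)"
proof -
  have "(weight_mat A *v x) $ i = norm (proj_mat A *v axis i 1) * x $ i" for i
    by (simp add: weight_mat_def matrix_vector_mult_def if_distrib[of "\<lambda>c. c * _"] cong: if_cong)
  then show ?thesis
    by (simp add: norm_l1_def abs_mult)
qed

lemma matrix_mult_proj_mat: "A *v (proj_mat A *v x) = A *v x"
  using proj_mat_orthogonal_projection(2)[of x A]
  by (simp add: null_space_def matrix_vector_mult_diff_distrib)

text \<open>
  The combination \<open>\<Sum>i. h\<^sub>i P e\<^sub>i\<close> is \<open>P h\<close>, which vanishes on the null space; and since \<open>A P = A\<close>,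
  columns of \<open>P\<close> can be parallel only where the columns of \<open>A\<close> are.
\<close>

lemma null_space_weighted_entry_lt:
  fixes A :: "real^'n^'m"
  assumes h: "A *v h = 0" "h \<noteq> 0"
    and "proj_mat A *v axis k 1 \<noteq> 0"
    and not_parallel: "\<And>i \<eta>. i \<noteq> k \<Longrightarrow> A *v axis i 1 \<noteq> \<eta> *\<^sub>R (A *v axis k 1)"
  shows "norm (proj_mat A *v axis k 1) * \<bar>h $ k\<bar>
    < (\<Sum>i\<in>UNIV - {k}. norm (proj_mat A *v axis i 1) * \<bar>h $ i\<bar>)"
proof -
  obtain j where j: "h $ j \<noteq> 0"
    using \<open>h \<noteq> 0\<close> by (auto simp: vec_eq_iff)
  have "(\<Sum>i\<in>UNIV. h $ i *\<^sub>R (proj_mat A *v axis i 1)) = proj_mat A *v h"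
    by (simp only: matrix_mult_sum[of _ h] matrix_vector_mult_basis scalar_mult_eq_scaleR)
  also have "\<dots> = 0"
    using h by (simp add: proj_mat_def matrix_vector_mul_assoc[symmetric])
  finally have vanish: "(\<Sum>i\<in>UNIV. h $ i *\<^sub>R (proj_mat A *v axis i 1)) = 0" .
  have "proj_mat A *v axis i 1 \<noteq> \<eta> *\<^sub>R (proj_mat A *v axis k 1)" if "i \<noteq> k" for i \<eta>
    using not_parallel[OF that, of \<eta>] by (metis matrix_mult_proj_mat matrix_vector_mult_scaleR)
  then show ?thesis
    using norm_lt_sum_norm_of_vanishing_combination[OF vanish assms(3) _ j] by blast
qed

theorem corollary4p2p1:
  fixes A :: "real^'n^'m"
    and J :: "'n set" and k :: 'n
    and xs :: "'n \<Rightarrow> real" and xk :: real and xstar :: "real^'n"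
  assumes "xstar = (\<Sum>j\<in>J. xs j *\<^sub>R axis j 1) + xk *\<^sub>R axis k 1"
    and "null_space A \<noteq> {0}"
    and "\<forall>i. proj_mat A *v axis i 1 \<noteq> 0"
    and "\<forall>j\<in>J. axis j 1 \<in> (null_space A)\<^sup>\<bottom>"
    and "k \<notin> J"
    and "\<forall>i l. i \<noteq> l \<longrightarrow> (\<forall>\<eta>::real. A *v axis i 1 \<noteq> \<eta> *\<^sub>R (A *v axis l 1))"
  shows "{x. is_arg_min (\<lambda>z. norm_l1 (weight_mat A *v z)) (\<lambda>z. A *v z = A *v xstar) x} = {xstar}"
proof -
  define w where "w i = norm (proj_mat A *v axis i 1)" for i
  have xstar_off: "xstar $ i = 0" if "i \<notin> J" "i \<noteq> k" for i
    using that unfolding assms(1) by (auto simp: axis_def intro!: sum.neutral)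
  have less: "norm_l1 (weight_mat A *v xstar) < norm_l1 (weight_mat A *v z)"
    if z: "A *v z = A *v xstar" "z \<noteq> xstar" for z
  proof -
    define h where "h = z - xstar"
    have h: "A *v h = 0" "h \<noteq> 0"
      using z by (simp_all add: h_def matrix_vector_mult_diff_distrib)
    have h_J: "h $ j = 0" if "j \<in> J" for j
    proof -
      have "orthogonal h (axis j 1)"
        using assms(4) that h by (auto simp: orthogonal_comp_def null_space_def)
      then show ?thesis
        by (simp add: orthogonal_def inner_axis)
    qed
    have zi: "z $ i = xstar $ i + h $ i" for i
      by (simp add: h_def)
    have off_k: "\<bar>z $ i\<bar> = \<bar>xstar $ i\<bar> + \<bar>h $ i\<bar>" if "i \<noteq> k" for i
      using that h_J[of i] xstar_off[of i] by (cases "i \<in> J") (auto simp: zi)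
    have "w k * \<bar>xstar $ k\<bar> \<le> w k * (\<bar>z $ k\<bar> + \<bar>h $ k\<bar>)"
      by (intro mult_left_mono) (auto simp: zi w_def)
    then have at_k: "w k * \<bar>xstar $ k\<bar> \<le> w k * \<bar>z $ k\<bar> + w k * \<bar>h $ k\<bar>"
      by (simp add: distrib_left)
    have "norm_l1 (weight_mat A *v xstar)
        = w k * \<bar>xstar $ k\<bar> + (\<Sum>i\<in>UNIV - {k}. w i * \<bar>xstar $ i\<bar>)"
      by (simp add: norm_l1_weight_mat w_def sum.remove[of UNIV k])
    also have "\<dots> < w k * \<bar>z $ k\<bar>
        + ((\<Sum>i\<in>UNIV - {k}. w i * \<bar>h $ i\<bar>) + (\<Sum>i\<in>UNIV - {k}. w i * \<bar>xstar $ i\<bar>))"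
      using at_k null_space_weighted_entry_lt[OF h, of k] assms(3,6) by (simp add: w_def)
    also have "\<dots> = w k * \<bar>z $ k\<bar> + (\<Sum>i\<in>UNIV - {k}. w i * \<bar>z $ i\<bar>)"
      by (simp add: off_k distrib_left sum.distrib)
    also have "\<dots> = norm_l1 (weight_mat A *v z)"
      by (simp add: norm_l1_weight_mat w_def sum.remove[of UNIV k])
    finally show ?thesis .
  qed
  show ?thesis
  proof (intro set_eqI iffI)
    fix x
    assume "x \<in> {x. is_arg_min (\<lambda>z. norm_l1 (weight_mat A *v z)) (\<lambda>z. A *v z = A *v xstar) x}"
    then show "x \<in> {xstar}"
      using less[of x] by (auto simp: is_arg_min_def)
  next
    fix x
    assume "x \<in> {xstar}"
    then show "x \<in> {x. is_arg_min (\<lambda>z. norm_l1 (weight_mat A *v z)) (\<lambda>z. A *v z = A *v xstar) x}"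
      using less by (fastforce simp: is_arg_min_def)
  qed
qed

end
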